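(* Let $a\ge b\ge 2$ be integers. If the spider $S(a,b,2)$ is $e$-positive, then \[a\in\bigcup_{q=1}^{b-2}\{m\in\mathbb N:\ (b+2)q\le m\le (b+1)q+b-2\}.\] Moreover, if $a\equiv 0\pmod 3$ and $b\equiv 1\pmod 3$, then $a\le 2b+4$. *)

theory Defs
  imports Complex_Main "HOL-Library.FuncSet"
begin

definition proper_colouring :: "'v set \<Rightarrow> 'v set set \<Rightarrow> ('v \<Rightarrow> nat) \<Rightarrow> bool" where
  "proper_colouring V E \<kappa> \<longleftrightarrow> (\<forall>u v. {u, v} \<in> E \<longrightarrow> u \<noteq> v \<longrightarrow> \<kappa> u \<noteq> \<kappa> v)"

text \<open>Coefficient of the monomial x^alpha (alpha a finitely supported exponent vector,
  variables x_0, x_1, ... indexed by nat) in the chromatic symmetric function X_G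
  = sum over proper colourings kappa : V -> nat of prod_v x_(kappa v).\<close>
definition chrom_coeff :: "'v set \<Rightarrow> 'v set set \<Rightarrow> (nat \<Rightarrow> nat) \<Rightarrow> nat" where
  "chrom_coeff V E \<alpha> = card {\<kappa> \<in> V \<rightarrow>\<^sub>E (UNIV :: nat set).
      proper_colouring V E \<kappa> \<and> (\<forall>i. card {v \<in> V. \<kappa> v = i} = \<alpha> i)}"

definition partitions_of :: "nat \<Rightarrow> nat list set" where
  "partitions_of n = {lam. sorted_wrt (\<ge>) lam \<and> 0 \<notin> set lam \<and> sum_list lam = n}"

text \<open>Coefficient of x^alpha in the elementary symmetric function
  e_lambda = prod_j e_(lambda_j), where e_k = sum of x_S over k-subsets S of nat.\<close>
definition elem_coeff :: "nat list \<Rightarrow> (nat \<Rightarrow> nat) \<Rightarrow> nat" where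
  "elem_coeff lam \<alpha> = card {Ss :: nat set list. length Ss = length lam \<and>
      (\<forall>j < length lam. finite (Ss ! j) \<and> card (Ss ! j) = lam ! j) \<and>
      (\<forall>i. length (filter (\<lambda>S. i \<in> S) Ss) = \<alpha> i)}"

text \<open>A finite graph G on n vertices is e-positive iff
  X_G = sum_{lambda |- n} c_lambda e_lambda with all c_lambda >= 0
  (equality of formal power series, i.e. of all monomial coefficients).\<close>
definition e_positive :: "'v set \<Rightarrow> 'v set set \<Rightarrow> bool" where
  "e_positive V E \<longleftrightarrow> (\<exists>c :: nat list \<Rightarrow> real.
     (\<forall>lam \<in> partitions_of (card V). c lam \<ge> 0) \<and>
     (\<forall>\<alpha> :: nat \<Rightarrow> nat. finite {i. \<alpha> i \<noteq> 0} \<longrightarrow>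
        real (chrom_coeff V E \<alpha>) = (\<Sum>lam \<in> partitions_of (card V). c lam * real (elem_coeff lam \<alpha>))))"

text \<open>The spider S(a,b,c): a centre 0 with three legs (paths) having a, b, c vertices;
  leg 1 = 1..a, leg 2 = a+1..a+b, leg 3 = a+b+1..a+b+c; total a+b+c+1 vertices.\<close>
definition spider_V :: "nat \<Rightarrow> nat \<Rightarrow> nat \<Rightarrow> nat set" where
  "spider_V a b c = {0..a+b+c}"

definition leg_edges :: "nat \<Rightarrow> nat \<Rightarrow> nat set set" where
  "leg_edges s l = (if l = 0 then {} else {{0, s + 1}} \<union> {{i, i + 1} | i. s + 1 \<le> i \<and> i < s + l})"

definition spider_E :: "nat \<Rightarrow> nat \<Rightarrow> nat \<Rightarrow> nat set set" where
  "spider_E a b c = leg_edges 0 a \<union> leg_edges a b \<union> leg_edges (a + b) c"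

end

theory Submission
  imports
    Defs
    "HOL-Computational_Algebra.Fundamental_Theorem_Algebra"
    "HOL-Computational_Algebra.Polynomial_FPS"
begin

text \<open>
  Write \<open>P\<^sub>n\<close> for the chromatic symmetric function of the path on \<open>n\<close> vertices. Then
  \<open>X = P\<^sub>n + P\<^sub>1 P\<^bsub>n-1\<^esub> + P\<^sub>2 P\<^bsub>n-2\<^esub> - P\<^bsub>b+1\<^esub> P\<^bsub>a+2\<^esub> - P\<^bsub>b+2\<^esub> P\<^bsub>a+1\<^esub>\<close> for the spider
  \<open>S(a,b,2)\<close> with \<open>n = a + b + 3\<close>, and \<open>\<Sum> P\<^sub>n z\<^sup>n = E / (E - z E')\<close> with \<open>E = \<Sum> e\<^sub>k z\<^sup>k\<close>. By the
  fundamental theorem of algebra there are complex values of finitely many variables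
  with \<open>E = 1 + s z\<^sup>m + t z\<^bsup>m+1\<^esup>\<close>; if \<open>s, t \<ge> 0\<close>, then \<open>e\<close>-positivity makes the value of \<open>X\<close>
  nonnegative.

  For \<open>m = b + 1\<close> and \<open>s = t = 1\<close> the value is \<open>- P\<^bsub>a+2\<^esub> - P\<^bsub>a+1\<^esub>\<close>, so neither \<open>a + 2\<close> nor
  \<open>a + 1\<close> is a sum of copies of \<open>b + 1\<close> and \<open>b + 2\<close>; this is the first claim. For \<open>m = 3\<close> and
  \<open>s = 1\<close> the value vanishes at \<open>t = 0\<close>, and its derivative there, the coefficient of \<open>e\<^sub>4 e\<^sub>3\<^sup>K\<close>
  with \<open>3 K + 4 = n\<close>, is negative if \<open>a > 2 b + 4\<close>; this is the second claim.
\<close>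

section \<open>Paths and spiders\<close>

text \<open>The weighted count of the proper colourings of a path on \<open>l\<close> vertices which is attached
  by its first vertex to a vertex of colour \<open>i\<close>.\<close>

fun leg_sum :: "'c set \<Rightarrow> ('c \<Rightarrow> 'a::comm_ring_1) \<Rightarrow> nat \<Rightarrow> 'c \<Rightarrow> 'a" where
  "leg_sum C x 0 i = 1"
| "leg_sum C x (Suc l) i = (\<Sum>j\<in>C - {i}. x j * leg_sum C x l j)"

fun path_sum :: "'c set \<Rightarrow> ('c \<Rightarrow> 'a::comm_ring_1) \<Rightarrow> nat \<Rightarrow> 'a" where
  "path_sum C x 0 = 1"
| "path_sum C x (Suc l) = (\<Sum>i\<in>C. x i * leg_sum C x l i)"

lemma leg_sum_Suc_diff:
  assumes "finite C" "i \<in> C"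
  shows "leg_sum C x (Suc l) i = path_sum C x (Suc l) - x i * leg_sum C x l i"
  using assms by (simp add: sum_diff1)

declare leg_sum.simps(2) [simp del] path_sum.simps(2) [simp del]

text \<open>Rewrite one factor \<open>x i * leg_sum C x l i\<close> as \<open>path_sum C x (Suc l) - leg_sum C x (Suc l) i\<close>,
  once for each leg.\<close>

lemma two_legs_shift:
  assumes "finite C"
  shows "(\<Sum>i\<in>C. x i * leg_sum C x a i * leg_sum C x (Suc b) i * h i)
       = path_sum C x (Suc b) * (\<Sum>i\<in>C. x i * leg_sum C x a i * h i)
         - path_sum C x (Suc a) * (\<Sum>i\<in>C. x i * leg_sum C x b i * h i)
         + (\<Sum>i\<in>C. x i * leg_sum C x (Suc a) i * leg_sum C x b i * h i)"
  by (simp add: leg_sum_Suc_diff[OF assms] sum_distrib_left algebra_simps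
      flip: sum.distrib sum_subtractf)

text \<open>Vertices move one at a time from the second leg to the first. For \<open>h = 1\<close>
  both products in \<open>two_legs_shift\<close> equal
  \<open>path_sum C x (Suc a) * path_sum C x (Suc b)\<close> and cancel.\<close>

lemma two_legs_path:
  assumes "finite C"
  shows "(\<Sum>i\<in>C. x i * leg_sum C x a i * leg_sum C x b i) = path_sum C x (Suc (a + b))"
proof (induction b arbitrary: a)
  case 0
  show ?case by (simp add: path_sum.simps)
next
  case (Suc b)
  show ?case
    using two_legs_shift[OF assms, of x a b "\<lambda>_. 1"] Suc[of "Suc a"]
    by (simp add: path_sum.simps)
qed

text \<open>The third leg is emptied onto the second in two shifts. Each shift leaves a difference
  of two products of paths, and the two-legged sum that remains is itself a path.\<close>

lemma spider_sum_2:
  assumes "finite C"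
  shows "(\<Sum>i\<in>C. x i * leg_sum C x a i * leg_sum C x b i * leg_sum C x 2 i)
       = path_sum C x (a + b + 3)
         + path_sum C x 1 * path_sum C x (a + b + 2) + path_sum C x 2 * path_sum C x (a + b + 1)
         - path_sum C x (b + 1) * path_sum C x (a + 2) - path_sum C x (b + 2) * path_sum C x (a + 1)"
proof -
  have comm: "(\<Sum>i\<in>C. x i * leg_sum C x a i * leg_sum C x b' i * leg_sum C x c i)
      = (\<Sum>i\<in>C. x i * leg_sum C x b' i * leg_sum C x c i * leg_sum C x a i)" for b' c
    by (simp add: mult_ac)
  have step: "(\<Sum>i\<in>C. x i * leg_sum C x a i * leg_sum C x b' i * leg_sum C x (Suc c) i)
      = path_sum C x (Suc c) * path_sum C x (Suc (a + b'))
        - path_sum C x (Suc b') * path_sum C x (Suc (a + c))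
        + (\<Sum>i\<in>C. x i * leg_sum C x a i * leg_sum C x (Suc b') i * leg_sum C x c i)" for b' c
    using two_legs_shift[OF assms, of x b' c "leg_sum C x a"]
    by (simp only: comm two_legs_path[OF assms] add.commute)
  show ?thesis
    using step[of b 1] step[of "Suc b" 0] two_legs_path[OF assms, of x a "Suc (Suc b)"]
    by (simp add: numeral_2_eq_2 numeral_3_eq_3)
qed

text \<open>Nonempty paths are split by the colour \<open>i\<close> of the first vertex, with
  generating function \<open>W i\<close>. The leg recursion gives
  \<open>W i * (1 + x i z) = x i z P\<close>. Multiplying \<open>P = 1 + \<Sum> W i\<close> by
  \<open>E\<close> then yields \<open>E P = E + z E' P\<close> without dividing.\<close>

lemma path_sum_fps:
  fixes x :: "'c \<Rightarrow> 'a::field_char_0"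
  assumes C: "finite C"
  defines "E \<equiv> \<Prod>i\<in>C. (1 + fps_const (x i) * fps_X)"
  shows "Abs_fps (path_sum C x) * (E - fps_X * fps_deriv E) = E"
proof -
  let ?P = "Abs_fps (path_sum C x)" and ?f = "\<lambda>i. 1 + fps_const (x i) * fps_X"
  \<comment> \<open>The index is shifted because \<open>x i * leg_sum C x l i\<close> weighs paths
    on \<open>l + 1\<close> vertices whose first vertex has colour \<open>i\<close>.\<close>
  define W where "W i = Abs_fps (\<lambda>n. case n of 0 \<Rightarrow> 0 | Suc l \<Rightarrow> x i * leg_sum C x l i)" for i
  have W: "W i * ?f i = fps_const (x i) * fps_X * ?P" if "i \<in> C" for i
  proof (rule fps_ext)
    fix n
    have "W i * ?f i = W i + fps_const (x i) * (fps_X * W i)" by (simp add: algebra_simps)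
    moreover have "fps_nth (W i + fps_const (x i) * (fps_X * W i)) n =
       fps_nth (fps_const (x i) * (fps_X * ?P)) n"
      by (auto simp: W_def leg_sum_Suc_diff[OF C that] algebra_simps split: nat.split)
    ultimately show "fps_nth (W i * ?f i) n = fps_nth (fps_const (x i) * fps_X * ?P) n"
      by (simp add: mult.assoc)
  qed
  have P: "?P = 1 + (\<Sum>i\<in>C. W i)"
  proof (rule fps_ext)
    fix n
    show "fps_nth ?P n = fps_nth (1 + (\<Sum>i\<in>C. W i)) n"
      by (cases n) (simp_all add: W_def fps_sum_nth path_sum.simps(2))
  qed
  have EW: "E * W i = ?P * (fps_X * (fps_const (x i) * (\<Prod>j\<in>C - {i}. ?f j)))" if "i \<in> C" for i
  proof -
    have "E * W i = (W i * ?f i) * (\<Prod>j\<in>C - {i}. ?f j)"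
      unfolding E_def using C that by (simp add: prod.remove mult_ac)
    then show ?thesis unfolding W[OF that] by (simp add: mult_ac)
  qed
  have dE: "fps_deriv E = (\<Sum>i\<in>C. fps_const (x i) * (\<Prod>j\<in>C - {i}. ?f j))"
    using C unfolding E_def
  proof (induction C)
    case (insert k C)
    have "(\<Sum>i\<in>C. fps_const (x i) * (\<Prod>j\<in>insert k C - {i}. ?f j))
       = (\<Sum>i\<in>C. ?f k * (fps_const (x i) * (\<Prod>j\<in>C - {i}. ?f j)))"
    proof (rule sum.cong[OF refl])
      fix i assume "i \<in> C"
      then have "insert k C - {i} = insert k (C - {i})" using insert by auto
      then show "fps_const (x i) * (\<Prod>j\<in>insert k C - {i}. ?f j)
          = ?f k * (fps_const (x i) * (\<Prod>j\<in>C - {i}. ?f j))"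
        using insert by (simp add: mult_ac)
    qed
    then show ?case
      using insert by (simp add: algebra_simps sum_distrib_left sum.distrib)
  qed simp
  have "E * ?P = E + (\<Sum>i\<in>C. E * W i)"
    by (subst P) (simp add: algebra_simps sum_distrib_left)
  also have "(\<Sum>i\<in>C. E * W i) = ?P * (fps_X * fps_deriv E)"
    unfolding dE by (simp add: EW sum_distrib_left)
  finally show ?thesis by (simp add: algebra_simps)
qed

section \<open>Colourings of the spider, summed leg by leg\<close>

lemma sum_PiE_insert:
  assumes "v \<notin> V"
  shows "(\<Sum>\<kappa>\<in>insert v V \<rightarrow>\<^sub>E C. f \<kappa>) = (\<Sum>\<kappa>\<in>V \<rightarrow>\<^sub>E C. \<Sum>j\<in>C. f (\<kappa>(v := j)))"
proof -
  have "(\<Sum>\<kappa>\<in>insert v V \<rightarrow>\<^sub>E C. f \<kappa>) = (\<Sum>(j, \<kappa>)\<in>C \<times> (V \<rightarrow>\<^sub>E C). f (\<kappa>(v := j)))"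
    unfolding PiE_insert_eq
    by (subst sum.reindex[OF inj_combinator[OF assms]]) (simp add: case_prod_unfold o_def)
  also have "\<dots> = (\<Sum>\<kappa>\<in>V \<rightarrow>\<^sub>E C. \<Sum>j\<in>C. f (\<kappa>(v := j)))"
    by (subst sum.swap) (simp add: sum.cartesian_product)
  finally show ?thesis .
qed

text \<open>The recursion mirrors \<open>leg_sum\<close>. The attaching vertex \<open>u\<close> is
  kept apart from the offset \<open>s\<close> because the centre 0 need not precede
  \<open>s + 1\<close>; after the first leg vertex the two coincide.\<close>

fun leg_ok :: "nat \<Rightarrow> nat \<Rightarrow> nat \<Rightarrow> (nat \<Rightarrow> 'c) \<Rightarrow> bool" where
  "leg_ok u s 0 \<kappa> = True"
| "leg_ok u s (Suc l) \<kappa> \<longleftrightarrow> \<kappa> u \<noteq> \<kappa> (Suc s) \<and> leg_ok (Suc s) (Suc s) l \<kappa>"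

lemma leg_ok_iff:
  "leg_ok u s (Suc l) \<kappa> \<longleftrightarrow> \<kappa> u \<noteq> \<kappa> (s + 1) \<and> (\<forall>i. s + 1 \<le> i \<and> i < s + Suc l \<longrightarrow> \<kappa> i \<noteq> \<kappa> (i + 1))"
proof (induction l arbitrary: u s)
  case (Suc l)
  have "leg_ok u s (Suc (Suc l)) \<kappa> \<longleftrightarrow> \<kappa> u \<noteq> \<kappa> (s + 1) \<and> leg_ok (Suc s) (Suc s) (Suc l) \<kappa>"
    by simp
  also have "\<dots> \<longleftrightarrow> \<kappa> u \<noteq> \<kappa> (s + 1) \<and>
      (\<forall>i. s + 1 \<le> i \<and> i < s + Suc (Suc l) \<longrightarrow> \<kappa> i \<noteq> \<kappa> (i + 1))"
    unfolding Suc
    by (auto simp: le_less Suc_le_eq) (metis Suc_lessI less_add_Suc1 add_Suc_right)+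
  finally show ?case .
qed auto

lemma proper_colouring_leg:
  "proper_colouring V (leg_edges s l) \<kappa> \<longleftrightarrow> leg_ok 0 s l \<kappa>"
proof (cases l)
  case 0
  then show ?thesis by (simp add: proper_colouring_def leg_edges_def)
next
  case (Suc k)
  have "proper_colouring V (leg_edges s l) \<kappa>"
    if "\<kappa> 0 \<noteq> \<kappa> (s + 1)" "\<forall>i. s + 1 \<le> i \<and> i < s + l \<longrightarrow> \<kappa> i \<noteq> \<kappa> (i + 1)"
    using that Suc by (fastforce simp: proper_colouring_def leg_edges_def doubleton_eq_iff)
  moreover have "\<kappa> 0 \<noteq> \<kappa> (s + 1) \<and> (\<forall>i. s + 1 \<le> i \<and> i < s + l \<longrightarrow> \<kappa> i \<noteq> \<kappa> (i + 1))"
    if proper: "proper_colouring V (leg_edges s l) \<kappa>"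
  proof (intro conjI allI impI)
    show "\<kappa> 0 \<noteq> \<kappa> (s + 1)"
      using proper Suc by (simp add: proper_colouring_def leg_edges_def)
    fix i assume "s + 1 \<le> i \<and> i < s + l"
    then have "{i, i + 1} \<in> leg_edges s l" using Suc by (auto simp: leg_edges_def)
    moreover have "i \<noteq> i + 1" by simp
    ultimately show "\<kappa> i \<noteq> \<kappa> (i + 1)" using proper unfolding proper_colouring_def by blast
  qed
  ultimately show ?thesis using leg_ok_iff[of 0 s k \<kappa>] Suc by blast
qed

lemma proper_colouring_Un:
  "proper_colouring V (E \<union> E') \<kappa> \<longleftrightarrow> proper_colouring V E \<kappa> \<and> proper_colouring V E' \<kappa>"
  by (auto simp: proper_colouring_def)

text \<open>The first leg vertex joins \<open>V\<close>, and its condition and weight join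
  \<open>F\<close>. The induction hypothesis removes the rest of the leg, and summing over the
  colour of that vertex is one step of \<open>leg_sum\<close>. A general \<open>F\<close> that looks
  only at \<open>V\<close> lets one leg be removed while others remain.\<close>

lemma sum_leg:
  fixes x :: "'c \<Rightarrow> 'a::comm_ring_1"
  assumes "finite C" "finite V" "u \<in> V" "V \<inter> {s + 1..s + l} = {}"
    and F: "\<And>\<kappa> \<kappa>'. (\<And>v. v \<in> V \<Longrightarrow> \<kappa> v = \<kappa>' v) \<Longrightarrow> F \<kappa> = F \<kappa>'"
  shows "(\<Sum>\<kappa>\<in>V \<union> {s + 1..s + l} \<rightarrow>\<^sub>E C.
             F \<kappa> * (of_bool (leg_ok u s l \<kappa>) * (\<Prod>v=s + 1..s + l. x (\<kappa> v))))
       = (\<Sum>\<kappa>\<in>V \<rightarrow>\<^sub>E C. F \<kappa> * leg_sum C x l (\<kappa> u))"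
  using assms(2-)
proof (induction l arbitrary: V u s F)
  case 0
  show ?case by simp
next
  case (Suc l)
  define v where "v = Suc s"
  define F' where "F' \<kappa> = F \<kappa> * (of_bool (\<kappa> u \<noteq> \<kappa> v) * x (\<kappa> v))" for \<kappa>
  have v: "v \<notin> V" "u \<noteq> v" using Suc.prems(1-3) by (auto simp: v_def)
  have iv: "{s + 1..s + Suc l} = insert v {v + 1..v + l}" by (auto simp: v_def)
  have F_upd: "F (\<kappa>(v := j)) = F \<kappa>" for \<kappa> j
    using v by (intro Suc.prems(4)) auto
  have "(\<Sum>\<kappa>\<in>V \<union> {s + 1..s + Suc l} \<rightarrow>\<^sub>E C.
             F \<kappa> * (of_bool (leg_ok u s (Suc l) \<kappa>) * (\<Prod>v=s + 1..s + Suc l. x (\<kappa> v))))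
      = (\<Sum>\<kappa>\<in>insert v V \<union> {v + 1..v + l} \<rightarrow>\<^sub>E C.
             F' \<kappa> * (of_bool (leg_ok v v l \<kappa>) * (\<Prod>v=v + 1..v + l. x (\<kappa> v))))"
    unfolding iv Un_insert_right Un_insert_left F'_def
    by (intro sum.cong refl) (auto simp: v_def)
  also have "\<dots> = (\<Sum>\<kappa>\<in>insert v V \<rightarrow>\<^sub>E C. F' \<kappa> * leg_sum C x l (\<kappa> v))"
  proof (rule Suc.IH)
    show "insert v V \<inter> {v + 1..v + l} = {}" using Suc.prems(3) by (auto simp: v_def)
    fix \<kappa> \<kappa>' :: "nat \<Rightarrow> 'c" assume "\<And>w. w \<in> insert v V \<Longrightarrow> \<kappa> w = \<kappa>' w"
    moreover from this have "F \<kappa> = F \<kappa>'" by (intro Suc.prems(4)) auto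
    ultimately show "F' \<kappa> = F' \<kappa>'" using Suc.prems(2) by (simp add: F'_def)
  qed (use Suc.prems(1) in auto)
  also have "\<dots> = (\<Sum>\<kappa>\<in>V \<rightarrow>\<^sub>E C. F \<kappa> * leg_sum C x (Suc l) (\<kappa> u))"
    unfolding sum_PiE_insert[OF v(1)]
  proof (intro sum.cong refl)
    fix \<kappa>
    have "(\<Sum>j\<in>C. F' (\<kappa>(v := j)) * leg_sum C x l ((\<kappa>(v := j)) v))
        = F \<kappa> * (\<Sum>j\<in>C. of_bool (\<kappa> u \<noteq> j) * (x j * leg_sum C x l j))"
      using v unfolding sum_distrib_left by (intro sum.cong refl) (simp add: F'_def F_upd mult_ac)
    also have "(\<Sum>j\<in>C. of_bool (\<kappa> u \<noteq> j) * (x j * leg_sum C x l j)) = leg_sum C x (Suc l) (\<kappa> u)"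
      unfolding leg_sum.simps using assms(1) by (intro sum.mono_neutral_cong_right) auto
    finally show "(\<Sum>j\<in>C. F' (\<kappa>(v := j)) * leg_sum C x l ((\<kappa>(v := j)) v))
        = F \<kappa> * leg_sum C x (Suc l) (\<kappa> u)" .
  qed
  finally show ?case .
qed

text \<open>The leg with the highest numbers is removed first, so that the remaining vertices always
  form an initial segment \<open>{0..s}\<close>. At the end only the colour of the centre is summed
  over.\<close>

lemma spider_colouring_sum:
  fixes x :: "nat \<Rightarrow> 'a::comm_ring_1"
  assumes C: "finite C"
  shows "(\<Sum>\<kappa> | \<kappa> \<in> spider_V a b c \<rightarrow>\<^sub>E C \<and> proper_colouring (spider_V a b c) (spider_E a b c) \<kappa>.
            \<Prod>v\<in>spider_V a b c. x (\<kappa> v))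
       = (\<Sum>i\<in>C. x i * leg_sum C x a i * leg_sum C x b i * leg_sum C x c i)"
proof -
  define w where "w s l \<kappa> = of_bool (leg_ok 0 s l \<kappa>) * (\<Prod>v=s + 1..s + l. x (\<kappa> v))"
    for s l and \<kappa> :: "nat \<Rightarrow> nat"
  define L where "L = leg_sum C x"
  have w_cong: "w s l \<kappa> = w s l \<kappa>'" if "\<And>v. v \<in> {0..s + l} \<Longrightarrow> \<kappa> v = \<kappa>' v" for s l \<kappa> \<kappa>'
  proof -
    have "leg_ok 0 s l \<kappa> \<longleftrightarrow> leg_ok 0 s l \<kappa>'"
      by (cases l) (use that in \<open>auto simp: leg_ok_iff simp del: leg_ok.simps(2)\<close>)
    moreover have "(\<Prod>v=s + 1..s + l. x (\<kappa> v)) = (\<Prod>v=s + 1..s + l. x (\<kappa>' v))"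
      using that by (intro prod.cong) auto
    ultimately show ?thesis by (simp add: w_def)
  qed
  have leg: "(\<Sum>\<kappa>\<in>{0..s + l} \<rightarrow>\<^sub>E C. F \<kappa> * w s l \<kappa>) = (\<Sum>\<kappa>\<in>{0..s} \<rightarrow>\<^sub>E C. F \<kappa> * L l (\<kappa> 0))"
    if "\<And>\<kappa> \<kappa>'. (\<And>v. v \<in> {0..s} \<Longrightarrow> \<kappa> v = \<kappa>' v) \<Longrightarrow> F \<kappa> = F \<kappa>'" for F s l
  proof -
    have "{0..s} \<union> {s + 1..s + l} = {0..s + l}" by auto
    then show ?thesis
      using sum_leg[of C "{0..s}" 0 s l F x, OF C _ _ _ that] unfolding w_def L_def by simp
  qed
  have split: "(\<Prod>v\<in>{0..s + l}. x (\<kappa> v)) = (\<Prod>v\<in>{0..s}. x (\<kappa> v)) * (\<Prod>v=s + 1..s + l. x (\<kappa> v))"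
    for s l and \<kappa> :: "nat \<Rightarrow> nat"
    by (subst prod.union_disjoint[symmetric]) (auto intro!: prod.cong)
  have "(\<Sum>\<kappa> | \<kappa> \<in> spider_V a b c \<rightarrow>\<^sub>E C \<and> proper_colouring (spider_V a b c) (spider_E a b c) \<kappa>.
            \<Prod>v\<in>spider_V a b c. x (\<kappa> v))
      = (\<Sum>\<kappa>\<in>spider_V a b c \<rightarrow>\<^sub>E C.
            of_bool (proper_colouring (spider_V a b c) (spider_E a b c) \<kappa>)
              * (\<Prod>v\<in>spider_V a b c. x (\<kappa> v)))"
    using C by (intro sum.mono_neutral_cong_left) (auto simp: spider_V_def intro!: finite_PiE)
  also have "\<dots> = (\<Sum>\<kappa>\<in>{0..a + b + c} \<rightarrow>\<^sub>E C. (x (\<kappa> 0) * w 0 a \<kappa> * w a b \<kappa>) * w (a + b) c \<kappa>)"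
    unfolding spider_V_def spider_E_def proper_colouring_Un proper_colouring_leg w_def split
      of_bool_conj split[where s = 0 and l = a, unfolded add_0]
    by (simp add: mult_ac)
  also have "\<dots> = (\<Sum>\<kappa>\<in>{0..a + b} \<rightarrow>\<^sub>E C. (x (\<kappa> 0) * w 0 a \<kappa> * w a b \<kappa>) * L c (\<kappa> 0))"
  proof (rule leg)
    fix \<kappa> \<kappa>' :: "nat \<Rightarrow> nat" assume eq: "\<And>v. v \<in> {0..a + b} \<Longrightarrow> \<kappa> v = \<kappa>' v"
    have "w 0 a \<kappa> = w 0 a \<kappa>'" "w a b \<kappa> = w a b \<kappa>'" by (auto intro!: w_cong eq)
    then show "x (\<kappa> 0) * w 0 a \<kappa> * w a b \<kappa> = x (\<kappa>' 0) * w 0 a \<kappa>' * w a b \<kappa>'"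
      using eq[of 0] by simp
  qed
  also have "\<dots> = (\<Sum>\<kappa>\<in>{0..a + b} \<rightarrow>\<^sub>E C. (x (\<kappa> 0) * w 0 a \<kappa> * L c (\<kappa> 0)) * w a b \<kappa>)"
    by (simp add: mult_ac)
  also have "\<dots> = (\<Sum>\<kappa>\<in>{0..a} \<rightarrow>\<^sub>E C. (x (\<kappa> 0) * w 0 a \<kappa> * L c (\<kappa> 0)) * L b (\<kappa> 0))"
  proof (rule leg)
    fix \<kappa> \<kappa>' :: "nat \<Rightarrow> nat" assume eq: "\<And>v. v \<in> {0..a} \<Longrightarrow> \<kappa> v = \<kappa>' v"
    have "w 0 a \<kappa> = w 0 a \<kappa>'" by (auto intro!: w_cong eq)
    then show "x (\<kappa> 0) * w 0 a \<kappa> * L c (\<kappa> 0) = x (\<kappa>' 0) * w 0 a \<kappa>' * L c (\<kappa>' 0)"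
      using eq[of 0] by simp
  qed
  also have "\<dots> = (\<Sum>\<kappa>\<in>{0..0 + a} \<rightarrow>\<^sub>E C. (x (\<kappa> 0) * L b (\<kappa> 0) * L c (\<kappa> 0)) * w 0 a \<kappa>)"
    by (simp add: mult_ac)
  also have "\<dots> = (\<Sum>\<kappa>\<in>{0..0::nat} \<rightarrow>\<^sub>E C. (x (\<kappa> 0) * L b (\<kappa> 0) * L c (\<kappa> 0)) * L a (\<kappa> 0))"
    by (rule leg[where s = 0 and l = a and F = "\<lambda>\<kappa>. x (\<kappa> 0) * L b (\<kappa> 0) * L c (\<kappa> 0)"]) simp
  also have "\<dots> = (\<Sum>i\<in>C. x i * L a i * L b i * L c i)"
    using sum_PiE_insert[where v = 0 and V = "{}" and C = C and f = "\<lambda>\<kappa>. (x (\<kappa> 0) * L b (\<kappa> 0) * L c (\<kappa> 0)) * L a (\<kappa> 0)"]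
    by (simp add: mult_ac)
  finally show ?thesis unfolding L_def .
qed

section \<open>Evaluation at finitely many variables\<close>

definition monomial_val :: "nat \<Rightarrow> (nat \<Rightarrow> 'a::comm_ring_1) \<Rightarrow> (nat \<Rightarrow> nat) \<Rightarrow> 'a" where
  "monomial_val M x \<alpha> = (\<Prod>i<M. x i ^ \<alpha> i)"

text \<open>A finite box that contains the exponent vectors of all colourings of \<open>n\<close>
  vertices with \<open>M\<close> colours and of all lists of at most \<open>n\<close> subsets of
  \<open>{..<M}\<close>. Both sides of the expansion thus become finite sums over one index
  set.\<close>

definition exponents :: "nat \<Rightarrow> nat \<Rightarrow> (nat \<Rightarrow> nat) set" where
  "exponents M n = {\<alpha>. (\<forall>i<M. \<alpha> i \<le> n) \<and> (\<forall>i\<ge>M. \<alpha> i = 0)}"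

definition esym :: "nat \<Rightarrow> (nat \<Rightarrow> 'a::comm_ring_1) \<Rightarrow> nat \<Rightarrow> 'a" where
  "esym M x k = (\<Sum>S | S \<subseteq> {..<M} \<and> card S = k. \<Prod>i\<in>S. x i)"

lemma finite_exponents: "finite (exponents M n)"
proof -
  have "exponents M n = {\<alpha>. \<forall>i. (i \<in> {..<M} \<longrightarrow> \<alpha> i \<in> {..n}) \<and> (i \<notin> {..<M} \<longrightarrow> \<alpha> i = 0)}"
    unfolding exponents_def by (auto simp: not_less)
  then show ?thesis using finite_set_of_finite_funs[of "{..<M}" "{..n}" 0] by simp
qed

lemma finite_support_exponents: "\<alpha> \<in> exponents M n \<Longrightarrow> finite {i. \<alpha> i \<noteq> 0}"
  by (rule finite_subset[of _ "{..<M}"]) (auto simp: exponents_def not_less intro: leI)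

text \<open>Colourings are grouped by their vector of colour class sizes, on which alone their
  weight depends.\<close>

lemma sum_monomials_chrom_coeff:
  fixes x :: "nat \<Rightarrow> 'a::comm_ring_1"
  assumes V: "finite V"
  shows "(\<Sum>\<alpha>\<in>exponents M (card V). of_nat (chrom_coeff V E \<alpha>) * monomial_val M x \<alpha>)
       = (\<Sum>\<kappa> | \<kappa> \<in> V \<rightarrow>\<^sub>E {..<M} \<and> proper_colouring V E \<kappa>. \<Prod>v\<in>V. x (\<kappa> v))"
proof -
  define K where "K = {\<kappa>. \<kappa> \<in> V \<rightarrow>\<^sub>E {..<M} \<and> proper_colouring V E \<kappa>}"
  define g where "g \<kappa> i = card {v \<in> V. \<kappa> v = i}" for \<kappa> :: "'b \<Rightarrow> nat" and i
  have finK: "finite K"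
    unfolding K_def using V by (intro finite_subset[OF _ finite_PiE[of V "\<lambda>_. {..<M}"]]) auto
  have gK: "g ` K \<subseteq> exponents M (card V)"
    using V by (fastforce simp: g_def K_def exponents_def not_le[symmetric] card_eq_0_iff
        dest: PiE_mem intro!: card_mono)
  have val: "(\<Prod>v\<in>V. x (\<kappa> v)) = monomial_val M x (g \<kappa>)" if "\<kappa> \<in> K" for \<kappa>
  proof -
    have "(\<Prod>v\<in>V. x (\<kappa> v)) = (\<Prod>i<M. \<Prod>v | v \<in> V \<and> \<kappa> v = i. x (\<kappa> v))"
      using that V by (intro prod.group[symmetric]) (auto simp: K_def)
    also have "\<dots> = monomial_val M x (g \<kappa>)"
      unfolding monomial_val_def g_def by (intro prod.cong refl) simp
    finally show ?thesis .
  qed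
  \<comment> \<open>\<open>chrom_coeff\<close> admits every natural number as a colour, but
    \<open>\<alpha>\<close> vanishes from \<open>M\<close> on, so a colour that is used lies below
    \<open>M\<close>.\<close>
  have fib: "{\<kappa> \<in> V \<rightarrow>\<^sub>E (UNIV :: nat set). proper_colouring V E \<kappa> \<and> (\<forall>i. card {v \<in> V. \<kappa> v = i} = \<alpha> i)}
      = {\<kappa> \<in> K. g \<kappa> = \<alpha>}" if "\<alpha> \<in> exponents M (card V)" for \<alpha>
  proof (intro equalityI subsetI)
    fix \<kappa> assume "\<kappa> \<in> {\<kappa> \<in> K. g \<kappa> = \<alpha>}"
    then show "\<kappa> \<in> {\<kappa> \<in> V \<rightarrow>\<^sub>E (UNIV :: nat set). proper_colouring V E \<kappa> \<and> (\<forall>i. card {v \<in> V. \<kappa> v = i} = \<alpha> i)}"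
      by (auto simp: K_def g_def PiE_def)
  next
    fix \<kappa> assume \<kappa>: "\<kappa> \<in> {\<kappa> \<in> V \<rightarrow>\<^sub>E (UNIV :: nat set). proper_colouring V E \<kappa> \<and> (\<forall>i. card {v \<in> V. \<kappa> v = i} = \<alpha> i)}"
    have "\<kappa> v < M" if "v \<in> V" for v
    proof (rule ccontr)
      assume "\<not> \<kappa> v < M"
      then have "card {w \<in> V. \<kappa> w = \<kappa> v} = 0"
        using \<kappa> \<open>\<alpha> \<in> exponents M (card V)\<close> by (simp add: exponents_def)
      then show False using V that by auto
    qed
    then show "\<kappa> \<in> {\<kappa> \<in> K. g \<kappa> = \<alpha>}"
      using \<kappa> by (auto simp: K_def g_def PiE_iff)
  qed
  have "(\<Sum>\<kappa>\<in>K. \<Prod>v\<in>V. x (\<kappa> v))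
      = (\<Sum>\<alpha>\<in>exponents M (card V). \<Sum>\<kappa> | \<kappa> \<in> K \<and> g \<kappa> = \<alpha>. \<Prod>v\<in>V. x (\<kappa> v))"
    by (rule sum.group[OF finK finite_exponents gK, symmetric])
  also have "\<dots> = (\<Sum>\<alpha>\<in>exponents M (card V). of_nat (chrom_coeff V E \<alpha>) * monomial_val M x \<alpha>)"
    by (intro sum.cong refl) (simp add: chrom_coeff_def fib val)
  finally show ?thesis by (simp add: K_def)
qed

section \<open>Products of elementary symmetric functions\<close>

definition subset_lists :: "nat \<Rightarrow> nat list \<Rightarrow> nat set list set" where
  "subset_lists M lam = {Ss. list_all2 (\<lambda>S k. S \<subseteq> {..<M} \<and> card S = k) Ss lam}"

lemma subset_lists_Cons:
  "subset_lists M (k # lam) =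
     (\<lambda>(S, Ss). S # Ss) ` ({S. S \<subseteq> {..<M} \<and> card S = k} \<times> subset_lists M lam)"
  by (auto simp: subset_lists_def list_all2_Cons2)

lemma finite_subset_lists: "finite (subset_lists M lam)"
proof (induction lam)
  case Nil
  show ?case by (simp add: subset_lists_def)
next
  case (Cons k lam)
  then show ?case unfolding subset_lists_Cons by (intro finite_imageI finite_cartesian_product) auto
qed

lemma sum_subset_lists:
  "(\<Sum>Ss\<in>subset_lists M lam. \<Prod>S\<leftarrow>Ss. \<Prod>i\<in>S. x i) = (\<Prod>k\<leftarrow>lam. esym M x k)"
proof (induction lam)
  case Nil
  have "subset_lists M [] = {[]}" by (auto simp: subset_lists_def)
  then show ?case by simp
next
  case (Cons k lam)
  have "(\<Sum>Ss\<in>subset_lists M (k # lam). \<Prod>S\<leftarrow>Ss. \<Prod>i\<in>S. x i)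
      = (\<Sum>(S, Ss)\<in>{S. S \<subseteq> {..<M} \<and> card S = k} \<times> subset_lists M lam.
           (\<Prod>i\<in>S. x i) * (\<Prod>S\<leftarrow>Ss. \<Prod>i\<in>S. x i))"
    unfolding subset_lists_Cons
    by (subst sum.reindex) (auto simp: inj_on_def case_prod_unfold intro!: sum.cong)
  also have "\<dots> = esym M x k * (\<Prod>k\<leftarrow>lam. esym M x k)"
    unfolding Cons[symmetric] unfolding esym_def sum_product by (simp add: sum.cartesian_product)
  finally show ?case by simp
qed

text \<open>The product expands into lists of subsets, grouped by the multiplicity of each index. An
  index lies in at most \<open>length lam\<close> sets, so \<open>length lam \<le> n\<close> keeps
  the multiplicities inside the box.\<close>

lemma sum_monomials_elem_coeff:
  fixes x :: "nat \<Rightarrow> 'a::comm_ring_1"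
  assumes len: "length lam \<le> n"
  shows "(\<Sum>\<alpha>\<in>exponents M n. of_nat (elem_coeff lam \<alpha>) * monomial_val M x \<alpha>)
       = (\<Prod>k\<leftarrow>lam. esym M x k)"
proof -
  define g where "g Ss i = length (filter (\<lambda>S. i \<in> S) Ss)" for Ss :: "nat set list" and i
  let ?K = "subset_lists M lam"
  have sub: "S \<subseteq> {..<M}" if "Ss \<in> ?K" "S \<in> set Ss" for S Ss
    using that by (auto simp: subset_lists_def list_all2_conv_all_nth in_set_conv_nth)
  have gK: "g ` ?K \<subseteq> exponents M n"
  proof -
    have "g Ss i \<le> n" if "Ss \<in> ?K" for Ss i
      using that len length_filter_le[of "\<lambda>S. i \<in> S" Ss]
      unfolding g_def subset_lists_def by (metis le_trans list_all2_lengthD mem_Collect_eq)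
    moreover have "g Ss i = 0" if "Ss \<in> ?K" "i \<ge> M" for Ss i
      using sub[OF that(1)] that(2) by (fastforce simp: g_def filter_empty_conv)
    ultimately show ?thesis by (auto simp: exponents_def)
  qed
  have val: "(\<Prod>S\<leftarrow>Ss. \<Prod>i\<in>S. x i) = monomial_val M x (g Ss)" if "\<forall>S\<in>set Ss. S \<subseteq> {..<M}" for Ss
    using that
  proof (induction Ss)
    case Nil
    show ?case by (simp add: g_def monomial_val_def)
  next
    case (Cons S Ss)
    have "(\<Prod>i\<in>S. x i) = (\<Prod>i<M. x i ^ of_bool (i \<in> S))"
      using Cons.prems by (intro prod.mono_neutral_cong_left) auto
    moreover have "g (S # Ss) i = of_bool (i \<in> S) + g Ss i" for i by (simp add: g_def)
    ultimately show ?case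
      using Cons by (simp add: monomial_val_def power_add prod.distrib)
  qed
  have fib: "{Ss :: nat set list. length Ss = length lam \<and>
      (\<forall>j < length lam. finite (Ss ! j) \<and> card (Ss ! j) = lam ! j) \<and>
      (\<forall>i. length (filter (\<lambda>S. i \<in> S) Ss) = \<alpha> i)} = {Ss \<in> ?K. g Ss = \<alpha>}"
    if \<alpha>: "\<alpha> \<in> exponents M n" for \<alpha>
  proof -
    have bound: "Ss ! j \<subseteq> {..<M}" if "\<forall>i. g Ss i = \<alpha> i" "j < length Ss" for Ss j
    proof
      fix i assume "i \<in> Ss ! j"
      then have "g Ss i \<noteq> 0"
        using \<open>j < length Ss\<close> by (auto simp: g_def filter_empty_conv)
      then show "i \<in> {..<M}" using that(1) \<alpha> by (cases "i < M") (auto simp: exponents_def)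
    qed
    moreover have "finite (Ss ! j)" if "\<forall>i. g Ss i = \<alpha> i" "j < length Ss" for Ss j
      using bound[OF that] finite_subset by blast
    ultimately show ?thesis
      by (auto simp: subset_lists_def list_all2_conv_all_nth fun_eq_iff g_def[symmetric])
  qed
  have "(\<Prod>k\<leftarrow>lam. esym M x k) = (\<Sum>Ss\<in>?K. \<Prod>S\<leftarrow>Ss. \<Prod>i\<in>S. x i)"
    by (rule sum_subset_lists[symmetric])
  also have "\<dots> = (\<Sum>\<alpha>\<in>exponents M n. \<Sum>Ss | Ss \<in> ?K \<and> g Ss = \<alpha>. \<Prod>S\<leftarrow>Ss. \<Prod>i\<in>S. x i)"
    by (rule sum.group[OF finite_subset_lists finite_exponents gK, symmetric])
  also have "\<dots> = (\<Sum>\<alpha>\<in>exponents M n. \<Sum>Ss | Ss \<in> ?K \<and> g Ss = \<alpha>. monomial_val M x \<alpha>)"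
    by (intro sum.cong refl) (use sub val in auto)
  also have "\<dots> = (\<Sum>\<alpha>\<in>exponents M n. of_nat (elem_coeff lam \<alpha>) * monomial_val M x \<alpha>)"
    by (intro sum.cong refl) (simp add: elem_coeff_def fib)
  finally show ?thesis by simp
qed

lemma length_partition_le:
  assumes "lam \<in> partitions_of n"
  shows "length lam \<le> n"
proof -
  have "0 \<notin> set lam \<Longrightarrow> length lam \<le> sum_list lam" by (induction lam) auto
  then show ?thesis using assms by (auto simp: partitions_of_def)
qed

text \<open>The identity of coefficients is multiplied by monomials and summed over the box. The
  variables may be complex: only the values of the elementary symmetric functions enter, and these
  are real and nonnegative.\<close>

lemma e_positive_value_nonneg:
  fixes x :: "nat \<Rightarrow> complex" and e :: "nat \<Rightarrow> real"
  assumes "e_positive V E" "finite V"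
    and e: "\<And>k. esym M x k = of_real (e k)" "\<And>k. e k \<ge> 0"
  shows "\<exists>r\<ge>0. (\<Sum>\<kappa> | \<kappa> \<in> V \<rightarrow>\<^sub>E {..<M} \<and> proper_colouring V E \<kappa>. \<Prod>v\<in>V. x (\<kappa> v)) = of_real r"
proof -
  let ?A = "exponents M (card V)" and ?L = "partitions_of (card V)"
  obtain c :: "nat list \<Rightarrow> real" where c: "\<And>lam. lam \<in> ?L \<Longrightarrow> c lam \<ge> 0"
    and chrom: "\<And>\<alpha>. finite {i. \<alpha> i \<noteq> 0} \<Longrightarrow>
        real (chrom_coeff V E \<alpha>) = (\<Sum>lam\<in>?L. c lam * real (elem_coeff lam \<alpha>))"
    using assms(1) unfolding e_positive_def by blast
  have "(\<Sum>\<kappa> | \<kappa> \<in> V \<rightarrow>\<^sub>E {..<M} \<and> proper_colouring V E \<kappa>. \<Prod>v\<in>V. x (\<kappa> v))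
      = (\<Sum>\<alpha>\<in>?A. of_real (real (chrom_coeff V E \<alpha>)) * monomial_val M x \<alpha>)"
    using sum_monomials_chrom_coeff[OF assms(2), where x = x and M = M] by simp
  also have "\<dots> = (\<Sum>\<alpha>\<in>?A. \<Sum>lam\<in>?L.
        of_real (c lam) * (of_nat (elem_coeff lam \<alpha>) * monomial_val M x \<alpha>))"
    by (intro sum.cong refl)
      (simp only: chrom[OF finite_support_exponents] of_real_sum of_real_mult of_real_of_nat_eq
        sum_distrib_right mult.assoc)
  also have "\<dots> = (\<Sum>lam\<in>?L. of_real (c lam) * (\<Prod>k\<leftarrow>lam. esym M x k))"
    by (subst sum.swap)
      (simp add: sum_distrib_left[symmetric] sum_monomials_elem_coeff length_partition_le)
  also have "\<dots> = of_real (\<Sum>lam\<in>?L. c lam * (\<Prod>k\<leftarrow>lam. e k))"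
  proof -
    have "(\<Prod>k\<leftarrow>lam. esym M x k) = of_real (\<Prod>k\<leftarrow>lam. e k)" for lam
      by (induction lam) (simp_all add: e)
    then show ?thesis by simp
  qed
  finally show ?thesis
    using c e(2) by (intro exI[of _ "\<Sum>lam\<in>?L. c lam * (\<Prod>k\<leftarrow>lam. e k)"] conjI)
      (auto intro!: sum_nonneg mult_nonneg_nonneg prod_list_nonneg)
qed

section \<open>Prescribing the values of the elementary symmetric functions\<close>

text \<open>Constant term 1 makes every root \<open>r\<close> nonzero, so a factor
  \<open>1 - z / r\<close> splits off and the quotient again has constant term 1.\<close>

lemma poly_eq_prod_linear:
  fixes p :: "complex poly"
  assumes "coeff p 0 = 1"
  shows "\<exists>M x. p = (\<Prod>i<(M::nat). [:1, x i:])"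
  using assms
proof (induction "degree p" arbitrary: p rule: less_induct)
  case less
  show ?case
  proof (cases "degree p = 0")
    case True
    then have "p = 1" using less.prems by (auto elim!: degree_eq_zeroE)
    then show ?thesis by (intro exI[of _ 0]) simp
  next
    case False
    then obtain r where r: "poly p r = 0"
      using fundamental_theorem_of_algebra_alt[of p] by (metis degree_pCons_0 less.prems)
    then obtain q where q: "p = [:- r, 1:] * q" by (auto simp: poly_eq_0_iff_dvd elim: dvdE)
    have "r \<noteq> 0" using r less.prems by (auto simp: poly_0_coeff_0)
    \<comment> \<open>From \<open>z - r = - r * (1 - z / r)\<close>.\<close>
    define q' where "q' = smult (- r) q"
    have p: "p = [:1, - 1 / r:] * q'"
      using \<open>r \<noteq> 0\<close> by (simp add: q q'_def smult_add_right)
    have "q' \<noteq> 0" using p less.prems by auto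
    then have "degree p = Suc (degree q')" unfolding p using \<open>r \<noteq> 0\<close> by (subst degree_mult_eq) auto
    moreover have "coeff q' 0 = 1" using less.prems unfolding p by (simp add: coeff_mult)
    ultimately obtain M x where "q' = (\<Prod>i<(M::nat). [:1, x i:])" using less.hyps[of q'] by auto
    then have "p = (\<Prod>i<Suc M. [:1, (x(M := - 1 / r)) i:])" unfolding p by simp
    then show ?thesis by blast
  qed
qed

lemma prod_fps_const: "(\<Prod>i\<in>S. fps_const (f i)) = fps_const (\<Prod>i\<in>S. f i)"
  by (induction S rule: infinite_finite_induct) simp_all

lemma prod_linear_fps_esym:
  fixes x :: "nat \<Rightarrow> 'a::field_char_0"
  shows "(\<Prod>i<M. (1 + fps_const (x i) * fps_X)) = Abs_fps (esym M x)"
proof (rule fps_ext)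
  fix k
  have "(\<Prod>i<M. (1 + fps_const (x i) * fps_X))
      = (\<Sum>S\<in>Pow {..<M}. fps_const (\<Prod>i\<in>S. x i) * fps_X ^ card S)"
    using prod_add[of "{..<M}" "\<lambda>i. fps_const (x i) * fps_X" "\<lambda>_. 1"]
    by (simp add: add.commute prod.distrib prod_fps_const)
  then have "fps_nth (\<Prod>i<M. (1 + fps_const (x i) * fps_X)) k
      = (\<Sum>S\<in>Pow {..<M}. (\<Prod>i\<in>S. x i) * (if k = card S then 1 else 0))"
    by (simp add: fps_sum_nth)
  also have "\<dots> = esym M x k"
    unfolding esym_def by (intro sum.mono_neutral_cong_right) auto
  finally show "fps_nth (\<Prod>i<M. (1 + fps_const (x i) * fps_X)) k = fps_nth (Abs_fps (esym M x)) k"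
    by simp
qed

section \<open>Two nonzero elementary symmetric functions\<close>

text \<open>The value of the chromatic symmetric function of the path on \<open>n\<close> vertices when
  \<open>e\<^sub>m = s\<close>, \<open>e\<^sub>m\<^sub>+\<^sub>1 = t\<close> and all other \<open>e\<^sub>k\<close> with \<open>k > 0\<close> vanish.\<close>

fun path_val :: "real \<Rightarrow> real \<Rightarrow> nat \<Rightarrow> nat \<Rightarrow> real" where
  "path_val s t m n =
     (if n = 0 then 1 else
       (if n = m then s else 0) + (if n = m + 1 then t else 0)
       + (if 0 < m \<and> m \<le> n then real (m - 1) * s * path_val s t m (n - m) else 0)
       + (if m + 1 \<le> n then real m * t * path_val s t m (n - (m + 1)) else 0))"

declare path_val.simps [simp del]

lemma path_val_0 [simp]: "path_val s t m 0 = 1"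
  by (simp add: path_val.simps)

lemma path_val_nonneg: "s \<ge> 0 \<Longrightarrow> t \<ge> 0 \<Longrightarrow> path_val s t m n \<ge> 0"
proof (induction n rule: less_induct)
  case (less n)
  then show ?case by (subst path_val.simps) auto
qed

lemma path_val_rec:
  assumes "m > 0" "n > m + 1"
  shows "path_val s t m n =
    real (m - 1) * s * path_val s t m (n - m) + real m * t * path_val s t m (n - (m + 1))"
  using assms by (subst path_val.simps) simp

lemma path_val_less: "0 < n \<Longrightarrow> n < m \<Longrightarrow> path_val s t m n = 0"
  by (subst path_val.simps) simp

text \<open>One copy of \<open>s\<close> is the inhomogeneous term; the recursion adds
  \<open>m - 1\<close> more through the value 1 at \<open>n - m = 0\<close>.\<close>

lemma path_val_eq: "0 < m \<Longrightarrow> path_val s t m m = real m * s"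
  by (subst path_val.simps) (simp add: of_nat_diff algebra_simps)

lemma path_val_Suc: "1 < m \<Longrightarrow> path_val s t m (Suc m) = real (Suc m) * t"
  by (subst path_val.simps) (simp add: path_val_less algebra_simps)

text \<open>For \<open>E = 1 + s z^m + t z^(m+1)\<close> one has
  \<open>E - z E' = 1 - (m-1) s z^m - m t z^(m+1)\<close>. Comparing coefficients in
  \<open>P (E - z E') = E\<close> gives the recursion of \<open>path_val\<close>, with the
  inhomogeneous terms coming from the right-hand side.\<close>

lemma path_sum_eq_path_val:
  fixes x :: "nat \<Rightarrow> complex"
  assumes m: "m > 0"
    and e: "\<And>k. esym M x k =
      of_real (if k = 0 then 1 else if k = m then s else if k = m + 1 then t else 0)"
  shows "path_sum {..<M} x n = of_real (path_val s t m n)"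
proof -
  define P where "P = Abs_fps (path_sum {..<M} x)"
  let ?E = "1 + fps_const (of_real s) * fps_X ^ m + fps_const (of_real t) * fps_X ^ (m + 1)"
  have E: "(\<Prod>i<M. (1 + fps_const (x i) * fps_X)) = ?E"
    unfolding prod_linear_fps_esym by (rule fps_ext) (use m in \<open>auto simp: e\<close>)
  let ?A = "fps_const (of_nat (m - 1) * of_real s) :: complex fps"
  let ?B = "fps_const (of_nat m * of_real t) :: complex fps"
  have "?E - fps_X * fps_deriv ?E = 1 - ?A * fps_X ^ m - ?B * fps_X ^ (m + 1)"
    by (rule fps_ext, unfold fps_sub_nth fps_mult_fps_X_deriv_shift)
      (use m in \<open>auto simp: of_nat_diff algebra_simps\<close>)
  then have "P * (1 - ?A * fps_X ^ m - ?B * fps_X ^ (m + 1)) = ?E"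
    using path_sum_fps[of "{..<M}" x, unfolded E] by (simp only: P_def finite_lessThan)
  moreover have "P = P * (1 - ?A * fps_X ^ m - ?B * fps_X ^ (m + 1))
      + ?A * (fps_X ^ m * P) + ?B * (fps_X ^ (m + 1) * P)"
    by (simp add: algebra_simps)
  ultimately have P: "P = ?E + ?A * (fps_X ^ m * P) + ?B * (fps_X ^ (m + 1) * P)"
    by simp
  have rec: "path_sum {..<M} x n = fps_nth ?E n
      + (if n < m then 0 else of_nat (m - 1) * of_real s * path_sum {..<M} x (n - m))
      + (if n < m + 1 then 0 else of_nat m * of_real t * path_sum {..<M} x (n - (m + 1)))" for n
  proof -
    have "path_sum {..<M} x n = fps_nth P n" by (simp add: P_def)
    also have "\<dots> = fps_nth ?E n
      + (if n < m then 0 else of_nat (m - 1) * of_real s * fps_nth P (n - m))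
      + (if n < m + 1 then 0 else of_nat m * of_real t * fps_nth P (n - (m + 1)))"
      by (subst P) (simp only: fps_add_nth fps_mult_left_const_nth fps_X_power_mult_nth, simp)
    finally show ?thesis by (simp add: P_def)
  qed
  show ?thesis
  proof (induction n rule: less_induct)
    case (less n)
    show ?case
    proof (cases "n = 0")
      case True
      then show ?thesis by simp
    next
      case False
      then show ?thesis
        by (subst rec, subst path_val.simps) (use m less in auto)
    qed
  qed
qed

lemma exists_esym_values:
  assumes "m > 0"
  shows "\<exists>M (x :: nat \<Rightarrow> complex). \<forall>k.
    esym M x k = of_real (if k = 0 then 1 else if k = m then s else if k = m + 1 then t else 0)"
proof -
  define p :: "complex poly" where "p = 1 + monom (of_real s) m + monom (of_real t) (m + 1)"
  have "coeff p 0 = 1" using assms by (simp add: p_def)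
  then obtain M x where p: "p = (\<Prod>i<(M::nat). [:1, x i:])" using poly_eq_prod_linear by blast
  have "fps_of_poly p = (\<Prod>i<M. (1 + fps_const (x i) * fps_X))"
    unfolding p by (simp add: fps_of_poly_prod fps_of_poly_pCons)
  then have "fps_nth (fps_of_poly p) k = esym M x k" for k
    by (simp add: prod_linear_fps_esym)
  then have "esym M x k = coeff p k" for k by simp
  then show ?thesis
    using assms by (intro exI[of _ M] exI[of _ x]) (auto simp: p_def)
qed

text \<open>This is the test used for both claims: \<open>spider_sum_2\<close> evaluated at the
  chosen \<open>m\<close>, \<open>s\<close>, \<open>t\<close>, with the negative terms moved to the
  left.\<close>

lemma e_positive_spider_2:
  assumes "e_positive (spider_V a b 2) (spider_E a b 2)" and "m > 0" "s \<ge> 0" "t \<ge> 0"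
  defines "P \<equiv> path_val s t m"
  shows "P (b + 1) * P (a + 2) + P (b + 2) * P (a + 1)
       \<le> P (a + b + 3) + P 1 * P (a + b + 2) + P 2 * P (a + b + 1)"
proof -
  obtain M and x :: "nat \<Rightarrow> complex" where e: "\<And>k. esym M x k =
      of_real (if k = 0 then 1 else if k = m then s else if k = m + 1 then t else 0)"
    using exists_esym_values[OF \<open>m > 0\<close>, of s t] by blast
  have "\<exists>r\<ge>0. (\<Sum>\<kappa> | \<kappa> \<in> spider_V a b 2 \<rightarrow>\<^sub>E {..<M} \<and>
      proper_colouring (spider_V a b 2) (spider_E a b 2) \<kappa>. \<Prod>v\<in>spider_V a b 2. x (\<kappa> v)) = of_real r"
    by (rule e_positive_value_nonneg[OF assms(1) _ e])
      (use assms(3,4) in \<open>simp_all add: spider_V_def\<close>)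
  then obtain r where "r \<ge> 0" and
    "path_sum {..<M} x (a + b + 3) + path_sum {..<M} x 1 * path_sum {..<M} x (a + b + 2)
      + path_sum {..<M} x 2 * path_sum {..<M} x (a + b + 1)
      - path_sum {..<M} x (b + 1) * path_sum {..<M} x (a + 2)
      - path_sum {..<M} x (b + 2) * path_sum {..<M} x (a + 1) = of_real r"
    by (auto simp: spider_colouring_sum spider_sum_2)
  then have "complex_of_real (P (a + b + 3) + P 1 * P (a + b + 2) + P 2 * P (a + b + 1)
      - P (b + 1) * P (a + 2) - P (b + 2) * P (a + 1)) = of_real r"
    unfolding path_sum_eq_path_val[OF \<open>m > 0\<close> e] by (simp add: P_def)
  then show ?thesis using \<open>r \<ge> 0\<close> unfolding of_real_eq_iff by linarith
qed

section \<open>First claim: sums of copies of \<open>b + 1\<close> and \<open>b + 2\<close>\<close>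

text \<open>Induction on the number of parts. Removing one part follows one term of the recursion,
  whose coefficient is positive since \<open>m > 1\<close>, and the other terms are
  nonnegative.\<close>

lemma path_val_pos:
  assumes "m > 1" "s > 0" "t > 0"
  shows "path_val s t m (i * m + j * (m + 1)) > 0"
proof (induction "i + j" arbitrary: i j)
  case 0
  then show ?case by simp
next
  case (Suc k)
  define n where "n = i * m + j * (m + 1)"
  have nonneg: "path_val s t m l \<ge> 0" for l using assms by (simp add: path_val_nonneg)
  have ge: "path_val s t m n \<ge> real (m - 1) * s * path_val s t m (n - m)" if "m \<le> n"
    using that assms nonneg by (subst (1) path_val.simps) auto
  have ge': "path_val s t m n \<ge> real m * t * path_val s t m (n - (m + 1))" if "m + 1 \<le> n"
    using that assms nonneg by (subst (1) path_val.simps) auto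
  have "path_val s t m n > 0"
  proof (cases i)
    case 0
    then obtain j' where j: "j = Suc j'" "k = 0 + j'" using Suc.hyps(2) by (cases j) auto
    then have "path_val s t m (n - (m + 1)) > 0" "m + 1 \<le> n"
      using Suc.hyps(1)[of 0 j'] 0 by (auto simp: n_def)
    moreover from this have "real m * t * path_val s t m (n - (m + 1)) > 0" using assms by simp
    ultimately show ?thesis using ge' by linarith
  next
    case (Suc i')
    then have "n - m = i' * m + j * (m + 1)" "m \<le> n" by (auto simp: n_def)
    then have "path_val s t m (n - m) > 0"
      using Suc.hyps(1)[of i' j] \<open>Suc k = i + j\<close> Suc by simp
    then have "real (m - 1) * s * path_val s t m (n - m) > 0" using assms by simp
    then show ?thesis using ge \<open>m \<le> n\<close> by linarith
  qed
  then show ?case by (simp only: n_def)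
qed

text \<open>With \<open>m = b + 1\<close> the left side of the test is
  \<open>(b+1) P(a+2) + (b+2) P(a+1)\<close>, while the right side is
  \<open>P(a+b+3) = b P(a+2) + (b+1) P(a+1)\<close>. Hence \<open>P(a+2) + P(a+1) \<le> 0\<close>,
  and both vanish.\<close>

lemma spider_2_not_representable:
  assumes e_pos: "e_positive (spider_V a b 2) (spider_E a b 2)" and "b \<ge> 2" "a > 0"
  shows "a + 2 \<noteq> i * (b + 1) + j * (b + 2)" "a + 1 \<noteq> i * (b + 1) + j * (b + 2)"
proof -
  define P where "P = path_val 1 1 (b + 1)"
  have "P 1 = 0" "P 2 = 0" using \<open>b \<ge> 2\<close> by (auto simp: P_def path_val_less)
  moreover have "P (b + 1) = real (b + 1)" unfolding P_def by (subst path_val_eq) auto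
  moreover have "P (b + 2) = real (b + 2)"
    using path_val_Suc[of "b + 1" 1 1] \<open>b \<ge> 2\<close> by (simp add: P_def)
  moreover have "P (a + b + 3) = real b * P (a + 2) + real (b + 1) * P (a + 1)"
    using path_val_rec[of "b + 1" "a + b + 3" 1 1] \<open>a > 0\<close> by (simp add: P_def)
  moreover have "P (b + 1) * P (a + 2) + P (b + 2) * P (a + 1)
      \<le> P (a + b + 3) + P 1 * P (a + b + 2) + P 2 * P (a + b + 1)"
    unfolding P_def by (rule e_positive_spider_2[OF e_pos]) auto
  ultimately have "P (a + 2) + P (a + 1) \<le> 0" by (simp add: algebra_simps)
  moreover have "P n \<ge> 0" for n by (simp add: P_def path_val_nonneg)
  ultimately have "P (a + 2) = 0" "P (a + 1) = 0" by (metis add_nonneg_eq_0_iff order_antisym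
      add_nonneg_nonneg)+
  moreover have "P (i * (b + 1) + j * (b + 2)) > 0"
    using path_val_pos[of "b + 1" 1 1 i j] \<open>b \<ge> 2\<close> by (simp add: P_def)
  ultimately show "a + 2 \<noteq> i * (b + 1) + j * (b + 2)" "a + 1 \<noteq> i * (b + 1) + j * (b + 2)"
    by force+
qed

text \<open>For \<open>a = (b+2) q + r\<close> the upper bound in the union says
  \<open>q + r \<le> b - 2\<close>. Otherwise \<open>a + 2\<close> or \<open>a + 1\<close> is a sum
  of \<open>q + 1\<close> parts \<open>b + 1\<close> and \<open>b + 2\<close>.\<close>

lemma spider_2_range:
  assumes e_pos: "e_positive (spider_V a b 2) (spider_E a b 2)" and "a \<ge> b" "b \<ge> 2"
  shows "a \<in> (\<Union>q \<in> {1..b-2}. {m. (b+2)*q \<le> m \<and> m \<le> (b+1)*q + b - 2})"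
proof -
  define q r where "q = a div (b + 2)" and "r = a mod (b + 2)"
  have a: "a = (b + 2) * q + r" by (simp only: q_def r_def mult_div_mod_eq)
  have r: "r < b + 2" by (simp add: r_def)
  have "\<not> b - 1 \<le> q + r"
  proof
    assume "b - 1 \<le> q + r"
    \<comment> \<open>Since \<open>a + 2 = (q+1) (b+2) - (b - r)\<close>, for
      \<open>r \<le> b\<close> exactly \<open>b - r\<close> of the \<open>q + 1\<close> parts are
      lowered to \<open>b + 1\<close> and \<open>j\<close> stay \<open>b + 2\<close>. The other case
      \<open>j > q + 1\<close> forces \<open>r = b + 1\<close>, where \<open>a + 1\<close> is a
      multiple of \<open>b + 2\<close>.\<close>
    define j where "j = q + r + 1 - b"
    have j: "j + b = q + r + 1" using \<open>b - 1 \<le> q + r\<close> \<open>b \<ge> 2\<close> by (simp add: j_def)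
    note not_rep = spider_2_not_representable[OF e_pos \<open>b \<ge> 2\<close>]
    show False
    proof (cases "j \<le> q + 1")
      case True
      define i where "i = q + 1 - j"
      have q: "q = i + j - 1" "i + j \<ge> 1" "r = b - i" "i \<le> b"
        using True j \<open>b - 1 \<le> q + r\<close> \<open>b \<ge> 2\<close> by (auto simp: i_def)
      have "b = i + r" "q + 1 = i + j" using q by auto
      then have "a + 2 = (b + 2) * (i + j) - i"
        unfolding a using q(2) by (cases "i + j") auto
      also have "\<dots> = i * (b + 1) + j * (b + 2)" by (simp add: algebra_simps)
      finally have "a + 2 = i * (b + 1) + j * (b + 2)" .
      then show False using not_rep(1)[of i j] assms by simp
    next
      case False
      then have "r = b + 1" using j r by linarith
      then have "a + 1 = 0 * (b + 1) + (q + 1) * (b + 2)" unfolding a by (simp add: algebra_simps)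
      then show False using not_rep(2)[of 0 "q + 1"] assms by simp
    qed
  qed
  then have "q + r + 2 \<le> b" using assms by linarith
  moreover have "q \<noteq> 0"
  proof
    assume "q = 0"
    then show False using \<open>q + r + 2 \<le> b\<close> a \<open>a \<ge> b\<close> by simp
  qed
  ultimately have "q \<in> {1..b - 2}" "(b + 2) * q \<le> a" "a \<le> (b + 1) * q + b - 2"
    unfolding a by (auto simp: algebra_simps)
  then show ?thesis by blast
qed

section \<open>Second claim: first order in \<open>t\<close> at \<open>m = 3\<close>,
  \<open>s = 1\<close>\<close>

lemma path_val_3_rec:
  "n > 1 \<Longrightarrow> path_val 1 t 3 (n + 3) = 2 * path_val 1 t 3 n + 3 * t * path_val 1 t 3 (n - 1)"
  using path_val_rec[of 3 "n + 3" 1 t] by simp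

lemma path_val_3_4: "path_val 1 t 3 4 = 4 * t"
  using path_val_Suc[of 3 1 t] by simp

text \<open>At \<open>t = 0\<close> the generating function is
  \<open>(1 + z^3) / (1 - 2 z^3)\<close>.\<close>

lemma path_val_3_at_0:
  "path_val 1 0 3 (3 * k + 3) = 3 * 2 ^ k" "path_val 1 0 3 (3 * k + 1) = 0"
  "path_val 1 0 3 (3 * k + 2) = 0"
proof -
  have step: "path_val 1 0 3 (3 * Suc k + i) = 2 * path_val 1 0 3 (3 * k + i)" if "3 * k + i > 1" for k i
    using path_val_3_rec[OF that, of 0] by (simp add: algebra_simps)
  show "path_val 1 0 3 (3 * k + 3) = 3 * 2 ^ k"
    using path_val_eq[of 3 1 0] by (induction k) (simp_all del: mult_Suc_right add: step)
  show "path_val 1 0 3 (3 * k + 2) = 0"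
    using step[of _ 2] by (induction k) (simp_all add: path_val_less)
  \<comment> \<open>The recursion \<open>step\<close> does not reach from index 1 to index 4, so the
    value at 4 is supplied by \<open>path_val_3_4\<close>.\<close>
  show "path_val 1 0 3 (3 * k + 1) = 0"
  proof (induction k)
    case (Suc k)
    then show ?case
      using step[of k 1] path_val_3_4[of 0] by (cases k) simp_all
  qed (simp add: path_val_less)
qed

text \<open>Bare existence suffices for the derivatives obtained from here: each is later multiplied
  by a factor that is 0 at \<open>t = 0\<close>.\<close>

lemma path_val_3_differentiable:
  "\<exists>D. ((\<lambda>t. path_val 1 t 3 n) has_real_derivative D) (at 0)"
proof (induction n rule: less_induct)
  case (less n)
  consider "n = 0" | "0 < n" "n < 3" | "n = 3" | "n = 4" | "n > 4" by linarith
  then show ?case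
  proof cases
    case 1
    then show ?thesis by (auto intro!: exI derivative_eq_intros)
  next
    case 2
    then show ?thesis by (auto simp: path_val_less intro!: exI derivative_eq_intros)
  next
    case 3
    then show ?thesis by (auto simp: path_val_eq intro!: exI derivative_eq_intros)
  next
    case 4
    then show ?thesis by (auto simp: path_val_3_4 intro!: exI derivative_eq_intros)
  next
    case 5
    then have rec: "path_val 1 t 3 n = 2 * path_val 1 t 3 (n - 3) + 3 * t * path_val 1 t 3 (n - 4)"
      for t using path_val_rec[of 3 n 1 t] by simp
    from less[of "n - 3"] less[of "n - 4"] 5 obtain D D' where
      "((\<lambda>t. path_val 1 t 3 (n - 3)) has_real_derivative D) (at 0)"
      "((\<lambda>t. path_val 1 t 3 (n - 4)) has_real_derivative D') (at 0)" by auto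
    then show ?thesis unfolding rec by (auto intro!: exI derivative_eq_intros)
  qed
qed

text \<open>The derivatives start at 4 and satisfy \<open>d (k+1) = 2 d k + 9 * 2^k\<close>, the
  last term being 3 times the value at index \<open>3 k + 3\<close>.\<close>

lemma path_val_3_deriv:
  "((\<lambda>t. path_val 1 t 3 (3 * k + 4)) has_real_derivative (9 * real k + 8) * 2 ^ k / 2) (at 0)"
proof (induction k)
  case 0
  show ?case by (auto simp: path_val_3_4 intro!: derivative_eq_intros)
next
  case (Suc k)
  have rec: "path_val 1 t 3 (3 * Suc k + 4)
      = 2 * path_val 1 t 3 (3 * k + 4) + 3 * t * path_val 1 t 3 (3 * k + 3)" for t
    using path_val_3_rec[of "3 * k + 4" t] by (simp add: algebra_simps)
  obtain D where "((\<lambda>t. path_val 1 t 3 (3 * k + 3)) has_real_derivative D) (at 0)"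
    using path_val_3_differentiable by blast
  from Suc this show ?case
    unfolding rec by (auto intro!: derivative_eq_intros simp: path_val_3_at_0) (simp add: field_simps)
qed

lemma spider_2_bound_mod_3:
  assumes e_pos: "e_positive (spider_V a b 2) (spider_E a b 2)" and "b \<ge> 2"
    and "a mod 3 = 0" "b mod 3 = 1"
  shows "a \<le> 2 * b + 4"
proof (rule ccontr)
  assume "\<not> a \<le> 2 * b + 4"
  have "b = 3 * (b div 3 - 1) + 4" using assms(2,4) by presburger
  then obtain j where b: "b = 3 * j + 4" ..
  have "a = 3 * (a div 3 - 1) + 3" using \<open>\<not> a \<le> 2 * b + 4\<close> assms(3) by presburger
  then obtain k where a: "a = 3 * k + 3" ..
  have k: "k \<ge> 2 * j + 4" using \<open>\<not> a \<le> 2 * b + 4\<close> a b by linarith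
  let ?Q = "\<lambda>n t. path_val 1 t 3 n"
  \<comment> \<open>The terms with \<open>P 1\<close> and \<open>P 2\<close> are absent because both
    values are 0 for \<open>m = 3\<close>.\<close>
  define F where "F t = ?Q (a + b + 3) t - ?Q (b + 1) t * ?Q (a + 2) t - ?Q (b + 2) t * ?Q (a + 1) t"
    for t
  have F_nonneg: "F t \<ge> 0" if "t \<ge> 0" for t
    using e_positive_spider_2[OF e_pos, of 3 1 t] that by (simp add: F_def path_val_less)
  \<comment> \<open>The indices \<open>a + b + 3\<close> and \<open>a + 1\<close> appear in two
    forms: \<open>3 i + 1\<close> for the values at 0 and \<open>3 i + 4\<close> for the
    derivatives.\<close>
  have n: "a + b + 3 = 3 * (k + j + 2) + 4" "a + b + 3 = 3 * (k + j + 3) + 1"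
    "b + 1 = 3 * (j + 1) + 2" "a + 2 = 3 * (k + 1) + 2" "b + 2 = 3 * (j + 1) + 3"
    "a + 1 = 3 * k + 4" "a + 1 = 3 * (k + 1) + 1"
    by (simp_all add: a b)
  have "F 0 = 0" unfolding F_def n(2-5,7) path_val_3_at_0 by simp
  have at_0: "?Q (b + 1) 0 = 0" "?Q (a + 2) 0 = 0" "?Q (a + 1) 0 = 0" "?Q (b + 2) 0 = 3 * 2 ^ (j + 1)"
    unfolding n(3-5,7) path_val_3_at_0 by simp_all
  obtain D1 D2 D3 where "(?Q (b + 1) has_real_derivative D1) (at 0)"
    "(?Q (a + 2) has_real_derivative D2) (at 0)" "(?Q (b + 2) has_real_derivative D3) (at 0)"
    using path_val_3_differentiable by metis
  moreover have "(?Q (a + b + 3) has_real_derivative (9 * real (k + j + 2) + 8) * 2 ^ (k + j + 2) / 2) (at 0)"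
    unfolding n(1) by (rule path_val_3_deriv)
  moreover have "(?Q (a + 1) has_real_derivative (9 * real k + 8) * 2 ^ k / 2) (at 0)"
    unfolding n(6) by (rule path_val_3_deriv)
  ultimately have "(F has_real_derivative (9 * real (k + j + 2) + 8) * 2 ^ (k + j + 2) / 2
      - 3 * 2 ^ (j + 1) * ((9 * real k + 8) * 2 ^ k / 2)) (at 0)"
    unfolding F_def by (auto intro!: derivative_eq_intros simp: at_0[simplified])
  moreover have "(9 * real (k + j + 2) + 8) * 2 ^ (k + j + 2) / 2
      - 3 * 2 ^ (j + 1) * ((9 * real k + 8) * 2 ^ k / 2)
      = 2 ^ (k + j) * (18 * real j + 28 - 9 * real k)"
    by (simp add: power_add field_simps)
  \<comment> \<open>The bracket is at most -8 for \<open>k \<ge> 2 * j + 4\<close>; at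
    \<open>k = 2 * j + 3\<close>, that is \<open>a = 2 * b + 4\<close>, it would be 1.\<close>
  moreover have "2 ^ (k + j) * (18 * real j + 28 - 9 * real k) < 0"
    using k by (intro mult_pos_neg) auto
  \<comment> \<open>\<open>F\<close> is known to be nonnegative only for \<open>t \<ge> 0\<close>,
    so the decrease is taken to the right of 0.\<close>
  ultimately obtain d where "d > 0" and d: "\<And>h. h > 0 \<Longrightarrow> h < d \<Longrightarrow> F (0 + h) < F 0"
    using DERIV_neg_dec_right[of F _ 0] by metis
  then have "F (d / 2) < 0" using \<open>F 0 = 0\<close> d[of "d / 2"] by simp
  then show False using F_nonneg[of "d / 2"] \<open>d > 0\<close> by simp
qed

theorem theorem4p3:
  fixes a b :: nat
  assumes "a \<ge> b" and "b \<ge> 2"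
    and "e_positive (spider_V a b 2) (spider_E a b 2)"
  shows "a \<in> (\<Union>q \<in> {1..b-2}. {m. (b+2)*q \<le> m \<and> m \<le> (b+1)*q + b - 2})
       \<and> (a mod 3 = 0 \<and> b mod 3 = 1 \<longrightarrow> a \<le> 2*b + 4)"
  by (intro conjI impI spider_2_range[OF assms(3,1,2)])
    (elim conjE, rule spider_2_bound_mod_3[OF assms(3,2)])

end
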